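(* Let $\Gamma$ be a numerical semigroup with embedding dimension $e$. Then $$W_\Gamma(e)\geq E(\Gamma)\geq W_\Gamma(e_s),$$ where $E(\Gamma)$ is the Eliahou number of $\Gamma$ and $e_s$ is the number of minimal generators of $\Gamma$ smaller than the conductor of $\Gamma$.
   Context: $\mathbb{N}$ denotes the set of nonnegative integers. A numerical semigroup $\Gamma$ is an additive submonoid of $(\mathbb{N},+)$ whose elements have greatest common divisor $1$, so that $\mathbb{N}\setminus\Gamma$ is finite; it is assumed that $\Gamma\neq\mathbb{N}$. The multiplicity is $m=m(\Gamma)=\min(\Gamma\setminus\{0\})$, the conductor is $c=c(\Gamma)=\max(\mathbb{N}\setminus\Gamma)+1$, and the delta-invariant $\delta(\Gamma)$ is the number of elements of $\Gamma$ (including $0$) that are smaller than $c$. $G$ denotes the (finite, unique) minimal system of generators of $\Gamma$, and $e=e(\Gamma)=|G|$ is the embedding dimension. The Wilf function is $W_\Gamma:\mathbb{N}\to\mathbb{Z}$, $W_\Gamma(k)=k\,\delta(\Gamma)-c(\Gamma)$. Eliahou number: put $q=\lceil c/m\rceil$, $\nu=qm-c$, $J_q=\{c,c+1,\ldots,c+m-1\}$, $p_q=J_q\cap G$, $d_q=J_q\setminus p_q$, and $e_s=|\{g\in G : g<c\}|$. Then $E(\Gamma)=e_s\,\delta(\Gamma)-q\,|d_q|+\nu$. *)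

theory Defs
  imports Complex_Main
begin

definition additive_submonoid :: "nat set \<Rightarrow> bool" where
  "additive_submonoid S \<longleftrightarrow> 0 \<in> S \<and> (\<forall>x\<in>S. \<forall>y\<in>S. x + y \<in> S)"

text \<open>The improper semigroup \<open>UNIV\<close> is not excluded by this definition.\<close>

definition numerical_semigroup :: "nat set \<Rightarrow> bool" where
  "numerical_semigroup \<Gamma> \<longleftrightarrow> additive_submonoid \<Gamma> \<and> Gcd \<Gamma> = 1"

definition ns_multiplicity :: "nat set \<Rightarrow> nat" where
  "ns_multiplicity \<Gamma> = (LEAST n. n \<in> \<Gamma> - {0})"

text \<open>\<open>Max\<close> is meaningful here only if the complement is finite and nonempty, that is, for
  numerical semigroups other than \<open>UNIV\<close>; see \<open>finite_gaps\<close>.\<close>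

definition conductor :: "nat set \<Rightarrow> nat" where
  "conductor \<Gamma> = Max (UNIV - \<Gamma>) + 1"

definition delta :: "nat set \<Rightarrow> nat" where
  "delta \<Gamma> = card {x \<in> \<Gamma>. x < conductor \<Gamma>}"

definition generates :: "nat set \<Rightarrow> nat set \<Rightarrow> bool" where
  "generates A \<Gamma> \<longleftrightarrow> additive_submonoid hull A = \<Gamma>"

definition minimal_generating_set :: "nat set \<Rightarrow> nat set \<Rightarrow> bool" where
  "minimal_generating_set A \<Gamma> \<longleftrightarrow> generates A \<Gamma> \<and> (\<forall>B. B \<subset> A \<longrightarrow> \<not> generates B \<Gamma>)"

text \<open>Existence, uniqueness and finiteness are proved below
  (\<open>ex1_minimal_generating_set\<close>, \<open>finite_min_gens\<close>).\<close>

definition min_gens :: "nat set \<Rightarrow> nat set" where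
  "min_gens \<Gamma> = (THE A. minimal_generating_set A \<Gamma>)"

definition embdim :: "nat set \<Rightarrow> nat" where
  "embdim \<Gamma> = card (min_gens \<Gamma>)"

definition small_embdim :: "nat set \<Rightarrow> nat" where
  "small_embdim \<Gamma> = card {g \<in> min_gens \<Gamma>. g < conductor \<Gamma>}"

definition wilf :: "nat set \<Rightarrow> nat \<Rightarrow> int" where
  "wilf \<Gamma> k = int k * int (delta \<Gamma>) - int (conductor \<Gamma>)"

definition eliahou :: "nat set \<Rightarrow> int" where
  "eliahou \<Gamma> =
    (let c = conductor \<Gamma>;
         m = ns_multiplicity \<Gamma>;
         q = \<lceil>real c / real m\<rceil>;
         \<nu> = q * int m - int c;
         J = {c..<c + m};
         p = J \<inter> min_gens \<Gamma>;
         d = J - p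
     in int (small_embdim \<Gamma>) * int (delta \<Gamma>) - q * int (card d) + \<nu>)"


lemma additive_submonoid_hull: "additive_submonoid (additive_submonoid hull A)"
  by (rule hull_in) (auto simp: additive_submonoid_def)

lemma finite_gaps:
  assumes "numerical_semigroup \<Gamma>"
  shows "finite (UNIV - \<Gamma>)"
proof -
  have z: "0 \<in> \<Gamma>" and add: "\<And>x y. x \<in> \<Gamma> \<Longrightarrow> y \<in> \<Gamma> \<Longrightarrow> x + y \<in> \<Gamma>" and g: "Gcd \<Gamma> = 1"
    using assms by (auto simp: numerical_semigroup_def additive_submonoid_def)
  have mul: "k * x \<in> \<Gamma>" if "x \<in> \<Gamma>" for k x
    by (induction k) (auto simp: z add that)
  define P where "P d \<longleftrightarrow> d > 0 \<and> (\<exists>a\<in>\<Gamma>. a + d \<in> \<Gamma>)" for d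
  obtain x0 where x0: "x0 \<in> \<Gamma>" "x0 \<noteq> 0"
  proof (cases "\<Gamma> \<subseteq> {0}")
    case True
    then have "Gcd \<Gamma> = 0" by simp
    then show thesis using g by simp
  qed (use that in blast)
  then have "P x0" using z unfolding P_def by force
  define d where "d = (LEAST d. P d)"
  have Pd: "P d" unfolding d_def by (rule LeastI) fact
  then obtain a where a: "d > 0" "a \<in> \<Gamma>" "a + d \<in> \<Gamma>" unfolding P_def by blast
  have "d dvd x" if x: "x \<in> \<Gamma>" for x
  proof (rule ccontr)
    assume "\<not> d dvd x"
    then have r: "x mod d > 0" by (simp add: dvd_eq_mod_eq_0)
    define k where "k = x div d"
    have xe: "k * d + x mod d = x" by (simp add: k_def)
    have "k * (a + d) \<in> \<Gamma>" "k * a + x \<in> \<Gamma>"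
      using mul a x add by auto
    moreover have "k * (a + d) + x mod d = k * a + x"
      using xe by (simp add: distrib_left)
    ultimately have "P (x mod d)" unfolding P_def using r by metis
    then have "d \<le> x mod d" unfolding d_def by (rule Least_le)
    then show False using mod_less_divisor[OF a(1), of x] by linarith
  qed
  then have "d dvd Gcd \<Gamma>" by (rule Gcd_greatest)
  then have d1: "d = 1" using g by simp
  have "n \<in> \<Gamma>" if n: "n \<ge> a * a" for n
  proof (cases "a = 0")
    case True
    then have "n * 1 \<in> \<Gamma>" using a d1 mul[of 1 n] by auto
    then show ?thesis by simp
  next
    case False
    define k r where "k = n div a" and "r = n mod a"
    have "r < a" using False by (simp add: r_def)
    moreover have "a \<le> k" unfolding k_def using n False by (simp add: less_eq_div_iff_mult_less_eq)
    ultimately have le: "r \<le> k" by simp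
    have "n = k * a + r" by (simp add: k_def r_def)
    also have "\<dots> = (k - r) * a + r * (a + d)"
      using le d1 by (simp add: diff_mult_distrib)
    also have "\<dots> \<in> \<Gamma>" by (intro add mul a)
    finally show ?thesis .
  qed
  then have "UNIV - \<Gamma> \<subseteq> {..<a * a}" using not_le by auto
  then show ?thesis by (rule finite_subset) simp
qed

definition irreducibles :: "nat set \<Rightarrow> nat set" where
  "irreducibles \<Gamma> =
    {g \<in> \<Gamma> - {0}. \<not> (\<exists>x\<in>\<Gamma> - {0}. \<exists>y\<in>\<Gamma> - {0}. g = x + y)}"

lemma generates_irreducibles:
  assumes "additive_submonoid \<Gamma>"
  shows "generates (irreducibles \<Gamma>) \<Gamma>"
proof -
  let ?H = "additive_submonoid hull irreducibles \<Gamma>"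
  have sub: "irreducibles \<Gamma> \<subseteq> ?H" by (rule hull_subset)
  have H: "0 \<in> ?H" "\<And>x y. x \<in> ?H \<Longrightarrow> y \<in> ?H \<Longrightarrow> x + y \<in> ?H"
    using additive_submonoid_hull[of "irreducibles \<Gamma>"] by (auto simp: additive_submonoid_def)
  have "x \<in> ?H" if "x \<in> \<Gamma>" for x
    using that
  proof (induction x rule: less_induct)
    case (less x)
    show ?case
    proof (cases "x = 0 \<or> x \<in> irreducibles \<Gamma>")
      case True
      then show ?thesis using H sub by auto
    next
      case False
      then obtain u v where "u \<in> \<Gamma>" "u \<noteq> 0" "v \<in> \<Gamma>" "v \<noteq> 0" "x = u + v"
        using less.prems unfolding irreducibles_def by blast
      then show ?thesis using H less.IH by simp
    qed
  qed
  moreover have "?H \<subseteq> \<Gamma>"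
    by (rule hull_minimal) (use assms in \<open>auto simp: irreducibles_def\<close>)
  ultimately show ?thesis unfolding generates_def by blast
qed

lemma irreducibles_subset_generating_set:
  assumes "generates A \<Gamma>"
  shows "irreducibles \<Gamma> \<subseteq> A"
proof
  fix g assume g: "g \<in> irreducibles \<Gamma>"
  have G: "additive_submonoid \<Gamma>" and AG: "A \<subseteq> \<Gamma>"
    using assms additive_submonoid_hull[of A] hull_subset[of A additive_submonoid]
    by (auto simp: generates_def)
  show "g \<in> A"
  proof (rule ccontr)
    assume "g \<notin> A"
    have "additive_submonoid (\<Gamma> - {g})"
      unfolding additive_submonoid_def
    proof (intro conjI ballI)
      show "0 \<in> \<Gamma> - {g}" using G g by (auto simp: additive_submonoid_def irreducibles_def)
      fix x y assume xy: "x \<in> \<Gamma> - {g}" "y \<in> \<Gamma> - {g}"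
      then have "x + y \<in> \<Gamma>" using G by (auto simp: additive_submonoid_def)
      moreover have "x + y \<noteq> g"
        using xy g unfolding irreducibles_def by (cases "x = 0"; cases "y = 0") auto
      ultimately show "x + y \<in> \<Gamma> - {g}" by simp
    qed
    then have "additive_submonoid hull A \<subseteq> \<Gamma> - {g}"
      by (intro hull_minimal) (use AG \<open>g \<notin> A\<close> in auto)
    then show False using assms g by (auto simp: generates_def irreducibles_def)
  qed
qed

lemma minimal_generating_set_iff:
  assumes "additive_submonoid \<Gamma>"
  shows "minimal_generating_set A \<Gamma> \<longleftrightarrow> A = irreducibles \<Gamma>"
  using generates_irreducibles[OF assms] irreducibles_subset_generating_set
  unfolding minimal_generating_set_def by blast

lemma ex1_minimal_generating_set:
  assumes "numerical_semigroup \<Gamma>"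
  shows "\<exists>!A. minimal_generating_set A \<Gamma>"
  using assms minimal_generating_set_iff by (auto simp: numerical_semigroup_def)

lemma min_gens_eq_irreducibles:
  assumes "numerical_semigroup \<Gamma>"
  shows "min_gens \<Gamma> = irreducibles \<Gamma>"
  using assms minimal_generating_set_iff by (simp add: min_gens_def numerical_semigroup_def)

lemma finite_min_gens:
  assumes "numerical_semigroup \<Gamma>"
  shows "finite (min_gens \<Gamma>)"
proof -
  have fin: "finite (UNIV - \<Gamma>)" by (rule finite_gaps) fact
  then obtain N where N: "\<And>n. n \<notin> \<Gamma> \<Longrightarrow> n \<le> N"
    unfolding finite_nat_set_iff_bounded_le by auto
  have "irreducibles \<Gamma> \<subseteq> {..2 * N + 2}"
  proof
    fix g assume g: "g \<in> irreducibles \<Gamma>"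
    show "g \<in> {..2 * N + 2}"
    proof (rule ccontr)
      assume "g \<notin> {..2 * N + 2}"
      then have gt: "g > 2 * N + 2" by simp
      have "\<not> N + 1 \<le> N" "\<not> g - (N + 1) \<le> N" using gt by linarith+
      then have "N + 1 \<in> \<Gamma>" "g - (N + 1) \<in> \<Gamma>" using N by blast+
      moreover have "g = (N + 1) + (g - (N + 1))" "N + 1 \<noteq> 0" "g - (N + 1) \<noteq> 0"
        using gt by simp_all
      ultimately have "\<exists>x\<in>\<Gamma> - {0}. \<exists>y\<in>\<Gamma> - {0}. g = x + y"
        by (metis DiffI singletonD)
      then show False using g unfolding irreducibles_def by blast
    qed
  qed
  then show ?thesis
    unfolding min_gens_eq_irreducibles[OF assms] by (rule finite_subset) simp
qed

end

theory Submission
  imports Defs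
begin

text \<open>
  Write \<open>c\<close> for the conductor, \<open>m\<close> for the multiplicity, \<open>q = \<lceil>c / m\<rceil>\<close>, and \<open>p\<close> for the set of
  minimal generators in \<open>J = {c..<c + m}\<close>. Since \<open>|J - p| = m - |p|\<close>, the terms \<open>q m\<close> cancel in the
  Eliahou number, which becomes \<open>e\<^sub>s \<delta> + q |p| - c\<close>: it is the Wilf function at \<open>e\<^sub>s\<close> plus \<open>q |p|\<close>.
  This gives the lower bound.

  Everything from \<open>c\<close> on lies in the semigroup, so a generator \<open>g \<ge> c + m\<close> would split as
  \<open>m + (g - m)\<close>. Hence \<open>p\<close> consists of all generators that are not small, \<open>e = e\<^sub>s + |p|\<close>, and the
  Wilf function at \<open>e\<close> exceeds the Eliahou number by \<open>(\<delta> - q) |p|\<close>. The upper bound then follows from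
  \<open>q \<le> \<delta>\<close> (\<open>ceiling_conductor_div_multiplicity_le_delta\<close>), which holds because the \<open>q\<close> multiples
  \<open>0, m, \<dots>, (q - 1) m\<close> of \<open>m\<close> all lie below \<open>c\<close>.
\<close>

lemma mem_if_conductor_le:
  assumes "numerical_semigroup \<Gamma>" and "conductor \<Gamma> \<le> x"
  shows "x \<in> \<Gamma>"
proof (rule ccontr)
  assume "x \<notin> \<Gamma>"
  then have "x \<le> Max (UNIV - \<Gamma>)"
    using finite_gaps[OF assms(1)] by (intro Max_ge) auto
  then show False using assms(2) by (simp add: conductor_def)
qed

lemma conductor_pos: "0 < conductor \<Gamma>"
  by (simp add: conductor_def)

lemma multiplicity_mem:
  assumes "numerical_semigroup \<Gamma>"
  shows "ns_multiplicity \<Gamma> \<in> \<Gamma> - {0}"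
  unfolding ns_multiplicity_def
proof (rule LeastI)
  show "conductor \<Gamma> \<in> \<Gamma> - {0}"
    using mem_if_conductor_le[OF assms order_refl] conductor_pos[of \<Gamma>] by simp
qed

text \<open>
  Subtracting \<open>m\<close> from an element \<open>g \<ge> c + m\<close> leaves a nonzero number that is at least \<open>c\<close>, hence in
  the semigroup; so \<open>g\<close> is a sum of two nonzero elements.
\<close>

lemma min_gens_less_conductor_plus_multiplicity:
  assumes "numerical_semigroup \<Gamma>" and "g \<in> min_gens \<Gamma>"
  shows "g < conductor \<Gamma> + ns_multiplicity \<Gamma>"
proof (rule ccontr)
  let ?m = "ns_multiplicity \<Gamma>"
  assume "\<not> ?thesis"
  then have le: "conductor \<Gamma> \<le> g - ?m" "g = ?m + (g - ?m)" by simp_all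
  have "g - ?m \<in> \<Gamma> - {0}"
    using mem_if_conductor_le[OF assms(1) le(1)] conductor_pos[of \<Gamma>] le(1) by auto
  then have "g \<notin> irreducibles \<Gamma>"
    using multiplicity_mem[OF assms(1)] le(2) unfolding irreducibles_def by blast
  then show False using assms min_gens_eq_irreducibles by simp
qed

lemma embdim_eq_small_embdim_plus:
  assumes "numerical_semigroup \<Gamma>"
  shows "embdim \<Gamma> = small_embdim \<Gamma>
    + card ({conductor \<Gamma>..<conductor \<Gamma> + ns_multiplicity \<Gamma>} \<inter> min_gens \<Gamma>)"
proof -
  let ?S = "{g \<in> min_gens \<Gamma>. g < conductor \<Gamma>}"
  let ?p = "{conductor \<Gamma>..<conductor \<Gamma> + ns_multiplicity \<Gamma>} \<inter> min_gens \<Gamma>"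
  have "min_gens \<Gamma> = ?S \<union> ?p"
    using min_gens_less_conductor_plus_multiplicity[OF assms] by auto
  moreover have "card (?S \<union> ?p) = card ?S + card ?p"
    using finite_min_gens[OF assms] by (intro card_Un_disjoint) auto
  ultimately show ?thesis by (simp add: embdim_def small_embdim_def)
qed

text \<open>
  The terms \<open>q m\<close> cancel: \<open>- q (m - |p|) + (q m - c) = q |p| - c\<close>.
\<close>

lemma eliahou_eq_wilf_plus:
  fixes \<Gamma> :: "nat set"
  defines "c \<equiv> conductor \<Gamma>" and "m \<equiv> ns_multiplicity \<Gamma>"
  shows "eliahou \<Gamma> = wilf \<Gamma> (small_embdim \<Gamma>)
    + \<lceil>real c / real m\<rceil> * int (card ({c..<c + m} \<inter> min_gens \<Gamma>))"
proof -
  let ?p = "{c..<c + m} \<inter> min_gens \<Gamma>"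
  have "card ?p \<le> card {c..<c + m}" by (intro card_mono) auto
  then have d: "int (card ({c..<c + m} - ?p)) = int m - int (card ?p)"
    by (simp add: card_Diff_subset of_nat_diff)
  show ?thesis
    unfolding eliahou_def wilf_def Let_def c_def[symmetric] m_def[symmetric] d
    by (simp add: algebra_simps)
qed

text \<open>
  Every \<open>i < \<lceil>c / m\<rceil>\<close> satisfies \<open>i m < c\<close>, so the multiples \<open>i m\<close> are \<open>\<lceil>c / m\<rceil>\<close> distinct elements
  of the kind that \<open>\<delta>\<close> counts.
\<close>

lemma ceiling_conductor_div_multiplicity_le_delta:
  assumes "numerical_semigroup \<Gamma>"
  shows "\<lceil>real (conductor \<Gamma>) / real (ns_multiplicity \<Gamma>)\<rceil> \<le> int (delta \<Gamma>)"
proof -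
  define c m where "c = conductor \<Gamma>" and "m = ns_multiplicity \<Gamma>"
  define q where "q = nat \<lceil>real c / real m\<rceil>"
  have m: "m \<in> \<Gamma>" "m > 0" using multiplicity_mem[OF assms] by (auto simp: m_def)
  have mult: "i * m \<in> \<Gamma>" for i
    using assms m
    by (induction i) (auto simp: numerical_semigroup_def additive_submonoid_def)
  have less: "i * m < c" if "i < q" for i
  proof -
    have "real i < real c / real m" using that unfolding q_def by linarith
    then have "real (i * m) < real c" using m by (simp add: field_simps)
    then show ?thesis by (simp only: of_nat_less_iff)
  qed
  have "q = card ((\<lambda>i. i * m) ` {..<q})"
    using m by (subst card_image) (auto simp: inj_on_def)
  also have "\<dots> \<le> delta \<Gamma>"
    unfolding delta_def c_def[symmetric] using mult less by (intro card_mono) auto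
  finally have "q \<le> delta \<Gamma>" .
  then show ?thesis unfolding q_def c_def m_def by linarith
qed

theorem theorem4p1:
  fixes \<Gamma> :: "nat set"
  assumes "numerical_semigroup \<Gamma>"
    and "\<Gamma> \<noteq> UNIV"
  shows "wilf \<Gamma> (embdim \<Gamma>) \<ge> eliahou \<Gamma> \<and> eliahou \<Gamma> \<ge> wilf \<Gamma> (small_embdim \<Gamma>)"
proof -
  define q where "q = \<lceil>real (conductor \<Gamma>) / real (ns_multiplicity \<Gamma>)\<rceil>"
  define P where
    "P = card ({conductor \<Gamma>..<conductor \<Gamma> + ns_multiplicity \<Gamma>} \<inter> min_gens \<Gamma>)"
  have E: "eliahou \<Gamma> = wilf \<Gamma> (small_embdim \<Gamma>) + q * int P"
    using eliahou_eq_wilf_plus[of \<Gamma>] by (simp add: q_def P_def)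
  have W: "wilf \<Gamma> (embdim \<Gamma>) = wilf \<Gamma> (small_embdim \<Gamma>) + int (delta \<Gamma>) * int P"
    unfolding wilf_def embdim_eq_small_embdim_plus[OF assms(1)] P_def[symmetric]
    by (simp add: algebra_simps)
  have "0 \<le> real (conductor \<Gamma>) / real (ns_multiplicity \<Gamma>)" by simp
  then have "0 \<le> q" unfolding q_def by linarith
  then have "0 \<le> q * int P" by simp
  moreover have "q * int P \<le> int (delta \<Gamma>) * int P"
    using ceiling_conductor_div_multiplicity_le_delta[OF assms(1)]
    by (intro mult_right_mono) (simp_all add: q_def)
  ultimately show ?thesis using E W by simp
qed

end
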